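(* A skew-symmetric graph $G$ is weakly acyclic if and only if there exists a partition of $V_G$ into sets $Z, Z', B_1,\ldots,B_k$ (for some $k\ge 0$, with $Z'$ the set of mates of nodes of $Z$) such that: (i) the (standard directed) subgraphs $G[Z]$ and $G[Z']$ are acyclic; (ii) the sets $B_i$ are self-symmetric and the subgraphs $G[B_i]$ are strongly connected and weakly acyclic; (iii) no arc connects distinct sets $B_i$ and $B_j$; (iv) no arc leaves $Z$ and no arc enters $Z'$.
   Context: All graphs are finite; parallel arcs and loops are allowed. A skew-symmetric graph is a digraph $G$ (node set $V_G$, arc set $A_G$) endowed with an involution $\sigma$ on $V_G\cup A_G$, mapping nodes to nodes and arcs to arcs, with no fixed nodes and no fixed arcs, such that for each arc $a$ from $u$ to $v$, $\sigma(a)$ is an arc from $\sigma(v)$ to $\sigma(u)$. We write $x'=\sigma(x)$ (the mate of $x$) and $X'=\sigma(X)$ for a set $X$ of nodes; $X$ is self-symmetric if $X'=X$. $G[X]$ is the induced directed subgraph on $X$; if $X'=X$ it is a skew-symmetric graph with the restricted symmetry. A circuit is a node-simple directed cycle. A circuit is regular if it contains no pair of arcs $a,a'$ that are mates. A skew-symmetric graph is weakly acyclic if it has no regular circuits. Strong connectivity is the usual directed notion. The sets $Z,Z'$ may be empty; the $B_i$ are nonempty. *)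

theory Defs
  imports "Graph_Theory.Graph_Theory" "HOL-Library.Disjoint_Sets"
begin

(* The involution on the disjoint union of nodes and arcs is given by its two components:
   \<sigma> on nodes and \<tau> on arcs. Their values outside verts G and arcs G are irrelevant. *)
locale skew_symmetric_graph = fin_digraph G
  for G :: "('a, 'b) pre_digraph" (structure) +
  fixes \<sigma> :: "'a \<Rightarrow> 'a" and \<tau> :: "'b \<Rightarrow> 'b"
  assumes node_mate_in_verts: "v \<in> verts G \<Longrightarrow> \<sigma> v \<in> verts G"
    and node_mate_mate: "v \<in> verts G \<Longrightarrow> \<sigma> (\<sigma> v) = v"
    and node_mate_neq: "v \<in> verts G \<Longrightarrow> \<sigma> v \<noteq> v"
    and arc_mate_in_arcs: "a \<in> arcs G \<Longrightarrow> \<tau> a \<in> arcs G"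
    and arc_mate_mate: "a \<in> arcs G \<Longrightarrow> \<tau> (\<tau> a) = a"
    and arc_mate_neq: "a \<in> arcs G \<Longrightarrow> \<tau> a \<noteq> a"
    and tail_arc_mate: "a \<in> arcs G \<Longrightarrow> tail G (\<tau> a) = \<sigma> (head G a)"
    and head_arc_mate: "a \<in> arcs G \<Longrightarrow> head G (\<tau> a) = \<sigma> (tail G a)"

(* pre_digraph.cycle is a nonempty closed arc walk without repeated nodes, so a single loop
   and a pair of antiparallel arcs both count as circuits. *)
definition acyclic_digraph :: "('a, 'b) pre_digraph \<Rightarrow> bool" where
  "acyclic_digraph H \<longleftrightarrow> (\<nexists>p. pre_digraph.cycle H p)"

definition regular_circuit :: "('b \<Rightarrow> 'b) \<Rightarrow> ('a, 'b) pre_digraph \<Rightarrow> 'b list \<Rightarrow> bool" where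
  "regular_circuit \<tau> H p \<longleftrightarrow> pre_digraph.cycle H p \<and> (\<forall>a \<in> set p. \<tau> a \<notin> set p)"

definition weakly_acyclic :: "('b \<Rightarrow> 'b) \<Rightarrow> ('a, 'b) pre_digraph \<Rightarrow> bool" where
  "weakly_acyclic \<tau> H \<longleftrightarrow> (\<nexists>p. regular_circuit \<tau> H p)"

(* Justifies using the same \<tau> when speaking of weak acyclicity of an induced subgraph. *)
lemma (in skew_symmetric_graph) skew_symmetric_graph_induce_subgraph:
  assumes "X \<subseteq> verts G" and "\<sigma> ` X = X"
  shows "skew_symmetric_graph (G \<restriction> X) \<sigma> \<tau>"
proof -
  have "finite X"
    using assms(1) finite_verts by (rule finite_subset)
  moreover have "\<sigma> v \<in> X" if "v \<in> X" for v
    using assms(2) that by blast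
  ultimately show ?thesis
    using assms(1)
    by unfold_locales
      (auto simp: node_mate_mate node_mate_neq arc_mate_in_arcs arc_mate_mate arc_mate_neq
        tail_arc_mate head_arc_mate subset_iff)
qed

end

theory Submission
  imports Defs
begin

text \<open>
  A node reaches its mate and conversely iff its strong component is self-symmetric; these
  components are the sets \<open>B\<^sub>i\<close>. Among the remaining nodes, take \<open>Z\<close> to be a maximal
  successor-closed set that is disjoint from its set of mates. As in the 2-SAT argument, a node
  outside \<open>Z \<union> Z' \<union> \<Union>B\<^sub>i\<close> or its mate could be added to \<open>Z\<close> together with everything
  reachable from it, so nothing is left over. Circuits inside \<open>Z\<close> or \<open>Z'\<close> are automatically
  regular. Conversely, a circuit cannot cross between the parts, so it lies inside a single one.
\<close>

section \<open>Circuits and successor-closed node sets in a digraph\<close>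

context wf_digraph
begin

text \<open>From \<open>head G a\<close> the rest of the closed walk leads to its base node
  \<open>u\<close>, and \<open>u\<close> reaches the tail of every arc of \<open>p\<close>; so the
  order of \<open>a\<close> and \<open>b\<close> in \<open>p\<close> is immaterial.\<close>

lemma cycle_head_reachable_tail:
  assumes "cycle p" "a \<in> set p" "b \<in> set p"
  shows "head G a \<rightarrow>\<^sup>* tail G b"
proof -
  obtain u where u: "awalk u p u"
    using assms(1) unfolding cycle_def by blast
  have "head G a \<rightarrow>\<^sup>* u"
    using awalk_verts_reachable_to[OF u] awalk_verts_arc2[OF _ assms(2)] u by blast
  moreover have "u \<rightarrow>\<^sup>* tail G b"
    using awalk_verts_reachable_from[OF u] awalk_verts_arc1[OF assms(3)] by blast
  ultimately show ?thesis
    by (rule reachable_trans)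
qed

lemma reachable_closed:
  assumes "u \<rightarrow>\<^sup>* v" "u \<in> X"
    and "\<And>a. a \<in> arcs G \<Longrightarrow> tail G a \<in> X \<Longrightarrow> head G a \<in> X"
  shows "v \<in> X"
  using assms(1,2) by (induction rule: reachable_induct) (use assms(3) in auto)

text \<open>Every tail is reachable from \<open>head G a\<close>, which closure puts into
  \<open>X\<close>. Thus a circuit cannot leave a successor-closed set that it meets.\<close>

lemma cycle_in_closed:
  assumes "cycle p" "a \<in> set p" "tail G a \<in> X" "b \<in> set p"
    and closed: "\<And>a. a \<in> arcs G \<Longrightarrow> tail G a \<in> X \<Longrightarrow> head G a \<in> X"
  shows "tail G b \<in> X" "head G b \<in> X"
proof -
  have arcs: "set p \<subseteq> arcs G"
    using assms(1) unfolding cycle_def by auto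
  show "tail G b \<in> X"
    using reachable_closed[OF cycle_head_reachable_tail] assms arcs by blast
  then show "head G b \<in> X"
    using closed arcs assms(4) by blast
qed

lemma cycle_induce_subgraphI:
  assumes "cycle p" "\<And>a. a \<in> set p \<Longrightarrow> tail G a \<in> X \<and> head G a \<in> X"
  shows "pre_digraph.cycle (G \<restriction> X) p"
proof -
  obtain u where u: "awalk u p u" "distinct (tl (awalk_verts u p))" "p \<noteq> []"
    using assms(1) unfolding cycle_def by blast
  have compat: "compatible G (G \<restriction> X)"
    by (simp add: compatible_def)
  \<comment> \<open>A walk of the subgraph must start at one of its nodes; since \<open>p\<close> is
    nonempty, \<open>u\<close> is the tail of its first arc.\<close>
  have "u \<in> X"
    using u(1,3) assms(2) by (cases p) (auto simp: awalk_Cons_iff)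
  then have "pre_digraph.awalk (G \<restriction> X) u p u"
    using u(1) assms(2) compatible_cas[OF compat]
    by (auto simp: pre_digraph.awalk_def)
  then show ?thesis
    using u(2,3) compatible_awalk_verts[OF compat]
    by (auto simp: pre_digraph.cycle_def)
qed

end

section \<open>Mates of paths, and circuits of induced subgraphs\<close>

context skew_symmetric_graph
begin

lemma reachable_mate:
  assumes "u \<rightarrow>\<^sup>* v"
  shows "\<sigma> v \<rightarrow>\<^sup>* \<sigma> u"
  using assms
proof (induction rule: reachable_induct)
  case base
  then show ?case by (simp add: node_mate_in_verts)
next
  case (step x y)
  from step(2) obtain a where "a \<in> arcs G" "tail G a = x" "head G a = y"
    by (rule reachableE)
  then have "\<sigma> y \<rightarrow>\<^bsub>G\<^esub> \<sigma> x"
    using arc_mate_in_arcs tail_arc_mate head_arc_mate in_arcs_imp_in_arcs_ends by metis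
  then show ?case
    using step(3) by (rule adj_reachable_trans)
qed

lemma cycle_induce_subgraphD:
  assumes "pre_digraph.cycle (G \<restriction> X) p" "X \<subseteq> verts G"
  shows "cycle p" "set p \<subseteq> arcs (G \<restriction> X)"
proof -
  show "cycle p"
    using subgraph_cycle[OF induced_imp_subgraph[OF induced_induce[OF assms(2)]] assms(1)] .
  show "set p \<subseteq> arcs (G \<restriction> X)"
    using assms(1) by (auto simp: pre_digraph.cycle_def pre_digraph.awalk_def)
qed

lemma weakly_acyclic_induce_subgraph:
  assumes "weakly_acyclic \<tau> G" "X \<subseteq> verts G"
  shows "weakly_acyclic \<tau> (G \<restriction> X)"
  using assms cycle_induce_subgraphD(1)
  unfolding weakly_acyclic_def regular_circuit_def by blast

text \<open>The mate of an arc inside \<open>X\<close> has its ends in the mate set of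
  \<open>X\<close>, hence outside \<open>X\<close>. So every circuit of the subgraph is
  regular.\<close>

lemma acyclic_induce_subgraph:
  assumes "weakly_acyclic \<tau> G" "X \<subseteq> verts G" "X \<inter> \<sigma> ` X = {}"
  shows "acyclic_digraph (G \<restriction> X)"
  unfolding acyclic_digraph_def
proof
  assume "\<exists>p. pre_digraph.cycle (G \<restriction> X) p"
  then obtain p where p: "pre_digraph.cycle (G \<restriction> X) p" ..
  note cyc = cycle_induce_subgraphD[OF p assms(2)]
  have "\<tau> a \<notin> set p" if "a \<in> set p" for a
  proof
    assume "\<tau> a \<in> set p"
    then have "tail G (\<tau> a) \<in> X"
      using cyc(2) by auto
    moreover have "tail G (\<tau> a) \<in> \<sigma> ` X"
      using that cyc(2) tail_arc_mate by auto
    ultimately show False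
      using assms(3) by blast
  qed
  with cyc(1) assms(1) show False
    unfolding weakly_acyclic_def regular_circuit_def by blast
qed

lemma mate_image_mate_image:
  assumes "X \<subseteq> verts G"
  shows "\<sigma> ` \<sigma> ` X = X"
  using assms node_mate_mate by (force simp: image_image)

section \<open>Construction of \<open>Z\<close> by maximal extension\<close>

definition self_mutual :: "'a set" where
  "self_mutual = {v \<in> verts G. v \<rightarrow>\<^sup>* \<sigma> v \<and> \<sigma> v \<rightarrow>\<^sup>* v}"

text \<open>In 2-SAT terms arcs are implications, mates are negations, and \<open>Z\<close> is a
  consistent partial assignment closed under implication. Closure speaks of paths rather than arcs
  to match extensions by whole reachable sets.\<close>

definition closed_mate_free :: "'a set \<Rightarrow> bool" where
  "closed_mate_free Z \<longleftrightarrow> Z \<subseteq> verts G - self_mutual \<and> Z \<inter> \<sigma> ` Z = {} \<and>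
    (\<forall>u\<in>Z. \<forall>v. u \<rightarrow>\<^sup>* v \<longrightarrow> v \<in> Z)"

lemma mate_self_mutual:
  assumes "v \<in> verts G"
  shows "\<sigma> v \<in> self_mutual \<longleftrightarrow> v \<in> self_mutual"
  using assms by (auto simp: self_mutual_def node_mate_mate node_mate_in_verts)

text \<open>If \<open>w\<close> reaches \<open>x\<close>, the mate path leads from
  \<open>\<sigma> x\<close> to \<open>\<sigma> w\<close>. Were \<open>\<sigma> x\<close> also
  reachable from \<open>w\<close>, then \<open>w\<close> would reach its own mate; were
  \<open>\<sigma> x\<close> in \<open>Z\<close>, closure would put \<open>\<sigma> w\<close> into
  \<open>Z\<close>, and \<open>w\<close> would be a mate of a node of \<open>Z\<close>.\<close>

lemma closed_mate_free_extend:
  assumes Z: "closed_mate_free Z" and w: "w \<in> verts G" "w \<notin> \<sigma> ` Z"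
    and no_mate: "\<not> w \<rightarrow>\<^sup>* \<sigma> w" and no_self: "\<And>x. w \<rightarrow>\<^sup>* x \<Longrightarrow> x \<notin> self_mutual"
  shows "closed_mate_free (Z \<union> {x. w \<rightarrow>\<^sup>* x})"
proof -
  let ?R = "{x. w \<rightarrow>\<^sup>* x}"
  have R: "?R \<subseteq> verts G"
    using reachable_in_verts by blast
  have ZV: "Z \<subseteq> verts G"
    using Z by (auto simp: closed_mate_free_def)
  have mate_path: "\<sigma> x \<rightarrow>\<^sup>* \<sigma> w" if "x \<in> ?R" for x
    using that reachable_mate by blast
  have closed: "v \<in> Z" if "u \<in> Z" "u \<rightarrow>\<^sup>* v" for u v
    using that Z by (auto simp: closed_mate_free_def)
  have ww: "\<sigma> w \<notin> Z"
    using w node_mate_mate by (metis imageI)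
  have RR: "\<sigma> x \<notin> ?R" if "x \<in> ?R" for x
    using that mate_path reachable_trans no_mate by blast
  have RZ: "\<sigma> x \<notin> Z" if "x \<in> ?R" for x
    using that mate_path closed ww by blast
  have ZR: "\<sigma> z \<notin> ?R" if "z \<in> Z" for z
    using that RZ[of "\<sigma> z"] ZV node_mate_mate by auto
  have "(Z \<union> ?R) \<inter> \<sigma> ` (Z \<union> ?R) = {}"
    using RR RZ ZR Z by (auto simp: closed_mate_free_def)
  moreover have "Z \<union> ?R \<subseteq> verts G - self_mutual"
    using Z R no_self by (auto simp: closed_mate_free_def)
  moreover have "\<forall>u\<in>Z \<union> ?R. \<forall>v. u \<rightarrow>\<^sup>* v \<longrightarrow> v \<in> Z \<union> ?R"
    using closed reachable_trans by blast
  ultimately show ?thesis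
    by (simp add: closed_mate_free_def)
qed

text \<open>Outside \<open>self_mutual\<close>, at least one of \<open>v\<close> and
  \<open>\<sigma> v\<close> fails to reach its mate. A node of \<open>self_mutual\<close> reachable
  from that one would supply a route to the mate, so the same choice of \<open>w\<close> avoids
  \<open>self_mutual\<close>.\<close>

lemma extendable_or_mate_extendable:
  assumes v: "v \<in> verts G" "v \<notin> self_mutual"
  obtains w where "w = v \<or> w = \<sigma> v" "\<not> w \<rightarrow>\<^sup>* \<sigma> w" "\<And>x. w \<rightarrow>\<^sup>* x \<Longrightarrow> x \<notin> self_mutual"
proof -
  have mm: "\<sigma> (\<sigma> v) = v"
    using v(1) by (rule node_mate_mate)
  \<comment> \<open>A path through \<open>x\<close> can be continued via \<open>\<sigma> x\<close> along the mate path.\<close>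
  have thru: "y \<rightarrow>\<^sup>* \<sigma> y" if "y \<rightarrow>\<^sup>* x" "x \<in> self_mutual" for x y
    using that reachable_mate[of y x] reachable_trans unfolding self_mutual_def by blast
  show thesis
  proof (cases "v \<rightarrow>\<^sup>* \<sigma> v")
    case True
    then have "\<not> \<sigma> v \<rightarrow>\<^sup>* v"
      using v by (simp add: self_mutual_def)
    then show thesis
      using that[of "\<sigma> v"] thru[of "\<sigma> v"] mm by metis
  next
    case False
    then show thesis
      using that[of v] thru[of v] by metis
  qed
qed

lemma ex_closed_mate_free_partition:
  obtains Z where "closed_mate_free Z" "Z \<union> \<sigma> ` Z \<union> self_mutual = verts G"
proof -
  have "finite {Z. closed_mate_free Z}"
    by (rule finite_subset[of _ "Pow (verts G)"]) (auto simp: closed_mate_free_def)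
  moreover have "closed_mate_free {}"
    by (simp add: closed_mate_free_def)
  ultimately obtain Z where Z: "closed_mate_free Z"
    and max: "\<And>Y. closed_mate_free Y \<Longrightarrow> Z \<subseteq> Y \<Longrightarrow> Z = Y"
    using finite_has_maximal[of "{Z. closed_mate_free Z}"] by auto
  have ZV: "Z \<subseteq> verts G"
    using Z by (auto simp: closed_mate_free_def)
  have "v \<in> Z \<union> \<sigma> ` Z" if v: "v \<in> verts G" "v \<notin> self_mutual" for v
  proof (rule ccontr)
    assume out: "v \<notin> Z \<union> \<sigma> ` Z"
    obtain w where w: "w = v \<or> w = \<sigma> v" "\<not> w \<rightarrow>\<^sup>* \<sigma> w"
        "\<And>x. w \<rightarrow>\<^sup>* x \<Longrightarrow> x \<notin> self_mutual"
      using extendable_or_mate_extendable[OF v] by blast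
    have wV: "w \<in> verts G"
      using w(1) v(1) node_mate_in_verts by blast
    \<comment> \<open>Either of \<open>v\<close> and \<open>\<sigma> v\<close> may turn out to be
      \<open>w\<close>, so the exclusion is established for both.\<close>
    have "\<sigma> v \<notin> Z \<union> \<sigma> ` Z"
      using out v(1) ZV node_mate_mate by (metis UnCI UnE image_iff subsetD)
    then have "w \<notin> Z" "w \<notin> \<sigma> ` Z"
      using w(1) out by (elim disjE; simp)+
    \<comment> \<open>Maximality forces equality, although the extension contains \<open>w\<close>,
      which reaches itself.\<close>
    then have "Z = Z \<union> {x. w \<rightarrow>\<^sup>* x}"
      using max[OF closed_mate_free_extend[OF Z wV _ w(2,3)]] by blast
    with \<open>w \<notin> Z\<close> wV show False
      by blast
  qed
  moreover have "\<sigma> ` Z \<subseteq> verts G"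
    using ZV node_mate_in_verts by blast
  ultimately have "Z \<union> \<sigma> ` Z \<union> self_mutual = verts G"
    using ZV by (auto simp: self_mutual_def)
  with Z show thesis
    by (rule that)
qed

section \<open>Self-symmetric strong components\<close>

lemma scc_of_self_mutual:
  assumes "v \<in> self_mutual"
  shows "scc_of v \<in> sccs_verts" "scc_of v \<subseteq> self_mutual" "\<sigma> ` scc_of v = scc_of v"
proof -
  have v: "v \<in> verts G" "v \<rightarrow>\<^sup>* \<sigma> v" "\<sigma> v \<rightarrow>\<^sup>* v"
    using assms by (auto simp: self_mutual_def)
  show "scc_of v \<in> sccs_verts"
    using v(1) by (rule scc_of_in_sccs_verts)
  \<comment> \<open>The mates of the paths between \<open>x\<close> and \<open>v\<close> join
    \<open>\<sigma> x\<close> and \<open>\<sigma> v\<close> in both directions, and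
    \<open>\<sigma> v\<close> is joined to \<open>v\<close> in the same way.\<close>
  have mate: "\<sigma> x \<in> scc_of v" if "x \<in> scc_of v" for x
    using that v reachable_mate[of x v] reachable_mate[of v x] reachable_trans
    unfolding scc_of_def by blast
  show "scc_of v \<subseteq> self_mutual"
  proof
    fix x assume x: "x \<in> scc_of v"
    with mate[OF x] show "x \<in> self_mutual"
      using reachable_trans reachable_in_verts unfolding scc_of_def self_mutual_def by blast
  qed
  have "scc_of v \<subseteq> verts G"
    using reachable_in_verts by (auto simp: scc_of_def)
  then show "\<sigma> ` scc_of v = scc_of v"
    using mate node_mate_mate by (metis image_subset_iff mate_image_mate_image image_mono subset_antisym)
qed

text \<open>An arc from \<open>x\<close> to \<open>y\<close> has a way back: from \<open>y\<close>
  to \<open>\<sigma> y\<close>, along the mate arc to \<open>\<sigma> x\<close>, and on to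
  \<open>x\<close>.\<close>

lemma scc_of_eq_if_adjacent:
  assumes "u \<in> self_mutual" "v \<in> self_mutual" "x \<in> scc_of u" "y \<in> scc_of v" "x \<rightarrow>\<^bsub>G\<^esub> y"
  shows "scc_of u = scc_of v"
proof -
  have x: "x \<in> self_mutual" and y: "y \<in> self_mutual"
    using scc_of_self_mutual(2) assms by blast+
  have "y \<rightarrow>\<^sup>* x"
    using x y reachable_mate[of x y] assms(5) reachable_trans unfolding self_mutual_def
    by blast
  then have "u \<rightarrow>\<^sup>* v" "v \<rightarrow>\<^sup>* u"
    using assms(3-5) reachable_trans reachable_adjI unfolding scc_of_def by blast+
  then show ?thesis
    using reachable_trans unfolding scc_of_def by blast
qed

end

theorem theorem3p3:
  fixes G :: "('a, 'b) pre_digraph" and \<sigma> :: "'a \<Rightarrow> 'a" and \<tau> :: "'b \<Rightarrow> 'b"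
  assumes "skew_symmetric_graph G \<sigma> \<tau>"
  shows "weakly_acyclic \<tau> G \<longleftrightarrow>
    (\<exists>(Z :: 'a set) (k :: nat) (B :: nat \<Rightarrow> 'a set).
      \<comment> \<open>partition of the node set\<close>
      Z \<union> \<sigma> ` Z \<union> (\<Union>i\<in>{1..k}. B i) = verts G \<and>
      Z \<inter> \<sigma> ` Z = {} \<and>
      (\<forall>i\<in>{1..k}. B i \<noteq> {} \<and> B i \<inter> (Z \<union> \<sigma> ` Z) = {}) \<and>
      disjoint_family_on B {1..k} \<and>
      \<comment> \<open>(i)\<close>
      acyclic_digraph (G \<restriction> Z) \<and> acyclic_digraph (G \<restriction> (\<sigma> ` Z)) \<and>
      \<comment> \<open>(ii)\<close>
      (\<forall>i\<in>{1..k}. \<sigma> ` B i = B i \<and> strongly_connected (G \<restriction> B i) \<and> weakly_acyclic \<tau> (G \<restriction> B i)) \<and>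
      \<comment> \<open>(iii)\<close>
      (\<forall>i\<in>{1..k}. \<forall>j\<in>{1..k}. i \<noteq> j \<longrightarrow>
        \<not> (\<exists>a\<in>arcs G. tail G a \<in> B i \<and> head G a \<in> B j)) \<and>
      \<comment> \<open>(iv)\<close>
      \<not> (\<exists>a\<in>arcs G. tail G a \<in> Z \<and> head G a \<notin> Z) \<and>
      \<not> (\<exists>a\<in>arcs G. tail G a \<notin> \<sigma> ` Z \<and> head G a \<in> \<sigma> ` Z))"
    (is "_ \<longleftrightarrow> (\<exists>Z k B. ?P Z k B)")
proof

  \<comment> \<open>The partition of a weakly acyclic graph\<close>
  interpret skew_symmetric_graph G \<sigma> \<tau> by (fact assms)
  assume wa: "weakly_acyclic \<tau> G"
  obtain Z where Z: "closed_mate_free Z" and cover: "Z \<union> \<sigma> ` Z \<union> self_mutual = verts G"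
    by (rule ex_closed_mate_free_partition)
  have ZV: "Z \<subseteq> verts G" "\<sigma> ` Z \<subseteq> verts G"
    using cover by blast+
  have ZZ: "Z \<inter> \<sigma> ` Z = {}"
    using Z by (simp add: closed_mate_free_def)
  have Z_closed: "head G a \<in> Z" if "a \<in> arcs G" "tail G a \<in> Z" for a
    using that Z in_arcs_imp_in_arcs_ends reachable_adjI unfolding closed_mate_free_def by metis
  \<comment> \<open>The mate of an arc entering the mate set of \<open>Z\<close> has its tail in
    \<open>Z\<close>, so \<open>Z_closed\<close> applies to \<open>\<tau> a\<close>.\<close>
  have Z'_closed: "tail G a \<in> \<sigma> ` Z" if a: "a \<in> arcs G" and "head G a \<in> \<sigma> ` Z" for a
  proof -
    have "tail G (\<tau> a) \<in> Z"
      using that ZV(1) tail_arc_mate node_mate_mate by auto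
    then have "\<sigma> (tail G a) \<in> Z"
      using Z_closed[of "\<tau> a"] a arc_mate_in_arcs head_arc_mate by simp
    then show ?thesis
      using a node_mate_mate[of "tail G a"] by (metis imageI tail_in_verts)
  qed
  \<comment> \<open>As \<open>self_mutual\<close> is closed under mates, avoiding \<open>Z\<close>
    entails avoiding the mates of \<open>Z\<close>.\<close>
  have self_disj: "self_mutual \<inter> (Z \<union> \<sigma> ` Z) = {}"
    using Z ZV(1) mate_self_mutual unfolding closed_mate_free_def by blast
  let ?C = "scc_of ` self_mutual"
  have "finite self_mutual"
    using finite_verts by (rule rev_finite_subset) (auto simp: self_mutual_def)
  \<comment> \<open>The set \<open>?C\<close> holds each component once, so a bijective enumeration
    gives distinct, hence disjoint, components at distinct indices.\<close>
  then obtain B where B: "bij_betw B {1..card ?C} ?C"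
    using ex_bij_betw_nat_finite_1 by blast
  have BC: "\<exists>v\<in>self_mutual. B i = scc_of v" if "i \<in> {1..card ?C}" for i
    using B that bij_betwE by blast
  have union: "(\<Union>i\<in>{1..card ?C}. B i) = self_mutual"
  proof -
    have "(\<Union>i\<in>{1..card ?C}. B i) = \<Union> ?C"
      using B by (simp add: bij_betw_def)
    also have "\<dots> = self_mutual"
      using scc_of_self_mutual(2) in_scc_of_self cover by blast
    finally show ?thesis .
  qed
  have B_sccs: "B i \<in> sccs_verts" "B i \<subseteq> self_mutual" "\<sigma> ` B i = B i"
    if "i \<in> {1..card ?C}" for i
    using BC[OF that] scc_of_self_mutual by metis+
  have B_inj: "B i \<noteq> B j" if "i \<in> {1..card ?C}" "j \<in> {1..card ?C}" "i \<noteq> j" for i j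
    using B that unfolding bij_betw_def inj_on_def by blast
  have "Z \<union> \<sigma> ` Z \<union> (\<Union>i\<in>{1..card ?C}. B i) = verts G"
    using cover union by simp
  moreover have "\<forall>i\<in>{1..card ?C}. B i \<noteq> {} \<and> B i \<inter> (Z \<union> \<sigma> ` Z) = {}"
  proof (intro ballI conjI)
    fix i assume i: "i \<in> {1..card ?C}"
    show "B i \<noteq> {}"
      using B_sccs(1)[OF i] by (simp add: sccs_verts_def)
    show "B i \<inter> (Z \<union> \<sigma> ` Z) = {}"
      using B_sccs(2)[OF i] self_disj by blast
  qed
  moreover have "disjoint_family_on B {1..card ?C}"
    unfolding disjoint_family_on_def using B_sccs(1) B_inj sccs_verts_disjoint by blast
  moreover have "acyclic_digraph (G \<restriction> Z)"
    using wa ZV(1) ZZ by (rule acyclic_induce_subgraph)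
  moreover have "acyclic_digraph (G \<restriction> (\<sigma> ` Z))"
    using ZZ mate_image_mate_image[OF ZV(1)]
    by (intro acyclic_induce_subgraph[OF wa ZV(2)]) (simp add: Int_commute)
  moreover have "\<forall>i\<in>{1..card ?C}. \<sigma> ` B i = B i \<and>
      strongly_connected (G \<restriction> B i) \<and> weakly_acyclic \<tau> (G \<restriction> B i)"
  proof (intro ballI conjI)
    fix i assume i: "i \<in> {1..card ?C}"
    show "\<sigma> ` B i = B i"
      using i by (rule B_sccs(3))
    show "strongly_connected (G \<restriction> B i)"
      using B_sccs(1)[OF i] by (simp add: in_sccs_verts_conv sccs_def)
    show "weakly_acyclic \<tau> (G \<restriction> B i)"
      using B_sccs(2)[OF i] cover by (intro weakly_acyclic_induce_subgraph[OF wa]) blast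
  qed
  moreover have "\<forall>i\<in>{1..card ?C}. \<forall>j\<in>{1..card ?C}. i \<noteq> j \<longrightarrow>
      \<not> (\<exists>a\<in>arcs G. tail G a \<in> B i \<and> head G a \<in> B j)"
    using BC B_inj scc_of_eq_if_adjacent in_arcs_imp_in_arcs_ends by metis
  moreover have "\<not> (\<exists>a\<in>arcs G. tail G a \<in> Z \<and> head G a \<notin> Z)"
    using Z_closed by blast
  moreover have "\<not> (\<exists>a\<in>arcs G. tail G a \<notin> \<sigma> ` Z \<and> head G a \<in> \<sigma> ` Z)"
    using Z'_closed by blast
  ultimately have "?P Z (card ?C) B"
    using ZZ by (intro conjI)
  then show "\<exists>Z k B. ?P Z k B"
    by - (rule exI[of _ Z], rule exI[of _ "card ?C"], rule exI[of _ B])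
next

  \<comment> \<open>Weak acyclicity from a given partition\<close>
  interpret skew_symmetric_graph G \<sigma> \<tau> by (fact assms)
  assume "\<exists>Z k B. ?P Z k B"
  then show "weakly_acyclic \<tau> G"
  proof (elim exE conjE)
    fix Z :: "'a set" and k :: nat and B :: "nat \<Rightarrow> 'a set"
    assume cover: "Z \<union> \<sigma> ` Z \<union> (\<Union>i\<in>{1..k}. B i) = verts G"
      and B: "\<forall>i\<in>{1..k}. B i \<noteq> {} \<and> B i \<inter> (Z \<union> \<sigma> ` Z) = {}"
      and acyc: "acyclic_digraph (G \<restriction> Z)" "acyclic_digraph (G \<restriction> (\<sigma> ` Z))"
      and B_wa: "\<forall>i\<in>{1..k}. \<sigma> ` B i = B i \<and> strongly_connected (G \<restriction> B i) \<and>
        weakly_acyclic \<tau> (G \<restriction> B i)"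
      and B_sep: "\<forall>i\<in>{1..k}. \<forall>j\<in>{1..k}. i \<noteq> j \<longrightarrow>
        \<not> (\<exists>a\<in>arcs G. tail G a \<in> B i \<and> head G a \<in> B j)"
      and Z_out: "\<not> (\<exists>a\<in>arcs G. tail G a \<in> Z \<and> head G a \<notin> Z)"
      and Z'_in: "\<not> (\<exists>a\<in>arcs G. tail G a \<notin> \<sigma> ` Z \<and> head G a \<in> \<sigma> ` Z)"
    have disj: "B i \<inter> (Z \<union> \<sigma> ` Z) = {}" if "i \<in> {1..k}" for i
      using B that by blast
    have wa: "weakly_acyclic \<tau> (G \<restriction> B i)" if "i \<in> {1..k}" for i
      using B_wa that by blast
    have no_arc: "head G a \<notin> B j"
      if "i \<in> {1..k}" "j \<in> {1..k}" "i \<noteq> j" "a \<in> arcs G" "tail G a \<in> B i" for i j a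
      using B_sep that by blast
    have Z_closed: "head G a \<in> Z" if "a \<in> arcs G" "tail G a \<in> Z" for a
      using Z_out that by blast
    \<comment> \<open>No arc enters the mate set of \<open>Z\<close>, so it is the complement that
      is successor-closed.\<close>
    have Z'_closed: "head G a \<in> - \<sigma> ` Z" if "a \<in> arcs G" "tail G a \<in> - \<sigma> ` Z" for a
      using Z'_in that by blast
    show ?thesis
      unfolding weakly_acyclic_def
    proof
      assume "\<exists>p. regular_circuit \<tau> G p"
      then obtain p where p: "cycle p" and reg: "\<forall>a\<in>set p. \<tau> a \<notin> set p"
        unfolding regular_circuit_def by blast
      have arcs: "set p \<subseteq> arcs G"
        using p unfolding cycle_def by auto
      have notZ: "tail G a \<notin> Z" if a: "a \<in> set p" for a
      proof
        assume "tail G a \<in> Z"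
        then have "pre_digraph.cycle (G \<restriction> Z) p"
          using cycle_in_closed[OF p a _ _ Z_closed] by (intro cycle_induce_subgraphI[OF p]) blast
        then show False
          using acyc(1) unfolding acyclic_digraph_def by blast
      qed
      \<comment> \<open>A circuit with a node outside the mate set of \<open>Z\<close> stays outside
        it; so a single tail inside forces the whole circuit inside.\<close>
      have notZ': "tail G a \<notin> \<sigma> ` Z" if a: "a \<in> set p" for a
      proof
        assume aZ: "tail G a \<in> \<sigma> ` Z"
        have tails: "tail G b \<in> \<sigma> ` Z" if "b \<in> set p" for b
          using cycle_in_closed(1)[OF p that _ a Z'_closed] aZ by blast
        moreover have "head G b \<in> \<sigma> ` Z" if "b \<in> set p" for b
          using reachable_closed[OF cycle_head_reachable_tail[OF p that a] _ Z'_closed] aZ by blast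
        ultimately have "pre_digraph.cycle (G \<restriction> (\<sigma> ` Z)) p"
          by (intro cycle_induce_subgraphI[OF p]) blast
        then show False
          using acyc(2) unfolding acyclic_digraph_def by blast
      qed
      have "p \<noteq> []"
        using p unfolding cycle_def by blast
      then obtain a where a: "a \<in> set p"
        by (cases p) auto
      then obtain i where i: "i \<in> {1..k}" and ai: "tail G a \<in> B i"
        using notZ notZ' cover arcs tail_in_verts by blast
      \<comment> \<open>Arcs may run from \<open>B i\<close> into \<open>Z\<close>, so
        \<open>B i\<close> alone may fail to be closed; once \<open>Z\<close> is added, the
        remaining exits, to the mates of \<open>Z\<close> and to other \<open>B j\<close>, are
        barred.\<close>
      have step: "head G b \<in> B i \<union> Z" if b: "b \<in> arcs G" and tb: "tail G b \<in> B i \<union> Z" for b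
      proof (cases "tail G b \<in> Z")
        case True
        then show ?thesis using Z_closed b by blast
      next
        case False
        then have tb: "tail G b \<in> B i"
          using tb by blast
        then have "head G b \<notin> \<sigma> ` Z"
          using Z'_closed[OF b] disj[OF i] by blast
        moreover have "head G b \<notin> B j" if "j \<in> {1..k}" "j \<noteq> i" for j
          using no_arc[OF i that(1) _ b tb] that(2) by blast
        ultimately show ?thesis
          using cover head_in_verts[OF b] by blast
      qed
      have tails: "tail G b \<in> B i" if "b \<in> set p" for b
        using cycle_in_closed(1)[OF p a _ that step] ai notZ[OF that] by blast
      \<comment> \<open>A head in \<open>Z\<close> would lead the circuit on to
        \<open>tail G a\<close> within \<open>Z\<close>, against \<open>notZ\<close>.\<close>
      have "head G b \<in> B i" if b: "b \<in> set p" for b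
      proof -
        have "head G b \<notin> Z"
          using reachable_closed[OF cycle_head_reachable_tail[OF p b a] _ Z_closed] notZ[OF a]
          by blast
        then show ?thesis
          using step tails[OF b] b arcs by blast
      qed
      then have "pre_digraph.cycle (G \<restriction> B i) p"
        using tails by (intro cycle_induce_subgraphI[OF p]) blast
      then show False
        using wa[OF i] reg unfolding weakly_acyclic_def regular_circuit_def by blast
    qed
  qed
qed

end
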